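(* Let $k$ be an integer with $|k|\ge 2$, let $n\ge 2$, let $0<r_1<\ldots<r_n$ and $\rho:=\{r_1,\ldots,r_n\}$. Let $\nu_1,\ldots,\nu_n$ be given real values and let $\sigma\in\mathcal{S}_k(\rho)$ be the unique Beppo Levi $L_k$-spline on $\rho$ satisfying $\sigma(r_j)=\nu_j$ for $j\in\{1,\ldots,n\}$. Then there exist unique coefficients $a_1,\ldots,a_n$ such that $$\sigma(r)=\sum_{j=1}^n a_j\,\varphi_k\!\left(\frac{r}{r_j}\right),\quad\forall r\ge 0.$$
   Context: For an integer $k\neq 0$ define the ordinary differential operators on $(0,\infty)$ $$L_k:=r\frac{d^4}{dr^4}+2\frac{d^3}{dr^3}-\frac{2k^2+1}{r}\frac{d^2}{dr^2}+\frac{2k^2+1}{r^2}\frac{d}{dr}+\frac{k^4-4k^2}{r^3}=r\left(\frac{d^2}{dr^2}+\frac1r\frac{d}{dr}-\frac{k^2}{r^2}\right)^2,$$ $$G_k:=\frac1r\left[\frac{d^2}{dr^2}-\frac{2|k|+1}{r}\frac{d}{dr}+\frac{|k|(|k|+2)}{r^2}\right],\qquad R_k:=\frac1r\left[\frac{d^2}{dr^2}+\frac{2|k|-1}{r}\frac{d}{dr}+\frac{|k|(|k|-2)}{r^2}\right].$$ Let $\rho=\{r_1,\ldots,r_n\}$ with $0<r_1<\ldots<r_n$. A function $\eta:[0,\infty)\to\mathbb{C}$ is called a Beppo Levi $L_k$-spline on $\rho$ if: (i) $L_k\eta(r)=0$ for all $r\in(r_j,r_{j+1})$ and all $j\in\{1,\ldots,n-1\}$;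 (ii) $G_k\eta(r)=0$ for all $r\in(0,r_1)$ and $R_k\eta(r)=0$ for all $r>r_n$; (iii) $\eta$ is $C^2$-continuous at each knot $r_1,\ldots,r_n$. The value at $0$ is understood by continuity, i.e. $\eta(0)=0$. The space of all Beppo Levi $L_k$-splines on $\rho$ is denoted $\mathcal{S}_k(\rho)$. For $n\ge2$, $k\ne0$ and given real values $\nu_1,\ldots,\nu_n$ there is a unique $\sigma\in\mathcal{S}_k(\rho)$ with $\sigma(r_j)=\nu_j$ for all $j$. The function $\varphi_k:[0,\infty)\to\mathbb{R}$ is defined by $$\varphi_k(r)=\frac12\,r^{|k|}\left[(1+|k|)+(1-|k|)r^2\right]\ \text{ for }0\le r\le1,\qquad \varphi_k(r)=\frac12\,r^{-|k|}\left[(1-|k|)+(1+|k|)r^2\right]\ \text{ for }r>1.$$ *)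

theory Defs
  imports "HOL-Analysis.Analysis"
begin

definition nderiv :: "nat \<Rightarrow> (real \<Rightarrow> complex) \<Rightarrow> real \<Rightarrow> complex" where
  "nderiv m f = ((\<lambda>g x. vector_derivative g (at x)) ^^ m) f"

text \<open>Since \<^const>\<open>vector_derivative\<close> is total, differentiability has to be required
  separately. Both notions below are meant for open sets.\<close>

definition times_differentiable_on :: "nat \<Rightarrow> (real \<Rightarrow> complex) \<Rightarrow> real set \<Rightarrow> bool" where
  "times_differentiable_on m f U \<longleftrightarrow> (\<forall>i<m. \<forall>x\<in>U. nderiv i f differentiable (at x))"

definition C_on :: "nat \<Rightarrow> (real \<Rightarrow> complex) \<Rightarrow> real set \<Rightarrow> bool" where
  "C_on m f U \<longleftrightarrow> times_differentiable_on m f U \<and> continuous_on U (nderiv m f)"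

definition C2_at :: "(real \<Rightarrow> complex) \<Rightarrow> real \<Rightarrow> bool" where
  "C2_at f x \<longleftrightarrow> (\<exists>e>0. C_on 2 f (ball x e))"

definition L_op :: "int \<Rightarrow> (real \<Rightarrow> complex) \<Rightarrow> real \<Rightarrow> complex" where
  "L_op k f r =
     r *\<^sub>R nderiv 4 f r + 2 *\<^sub>R nderiv 3 f r
     - ((2 * of_int k ^ 2 + 1) / r) *\<^sub>R nderiv 2 f r
     + ((2 * of_int k ^ 2 + 1) / r ^ 2) *\<^sub>R nderiv 1 f r
     + ((of_int k ^ 4 - 4 * of_int k ^ 2) / r ^ 3) *\<^sub>R f r"

definition G_op :: "int \<Rightarrow> (real \<Rightarrow> complex) \<Rightarrow> real \<Rightarrow> complex" where
  "G_op k f r = (1 / r) *\<^sub>R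
     (nderiv 2 f r - ((2 * of_int \<bar>k\<bar> + 1) / r) *\<^sub>R nderiv 1 f r
      + (of_int \<bar>k\<bar> * (of_int \<bar>k\<bar> + 2) / r ^ 2) *\<^sub>R f r)"

definition R_op :: "int \<Rightarrow> (real \<Rightarrow> complex) \<Rightarrow> real \<Rightarrow> complex" where
  "R_op k f r = (1 / r) *\<^sub>R
     (nderiv 2 f r + ((2 * of_int \<bar>k\<bar> - 1) / r) *\<^sub>R nderiv 1 f r
      + (of_int \<bar>k\<bar> * (of_int \<bar>k\<bar> - 2) / r ^ 2) *\<^sub>R f r)"

text \<open>The space of Beppo Levi splines with knots \<open>r 1 < \<dots> < r n\<close>. Its elements are functions on
  \<open>[0, \<infinity>)\<close>, encoded as total functions whose values at negative arguments are unconstrained.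
  On \<open>(0, r 1)\<close> a spline is a combination of \<open>t ^ \<bar>k\<bar>\<close> and \<open>t ^ (\<bar>k\<bar> + 2)\<close>, so for
  \<open>k \<noteq> 0\<close> the condition at \<open>0\<close> expresses continuity there.\<close>

definition BL_splines :: "int \<Rightarrow> nat \<Rightarrow> (nat \<Rightarrow> real) \<Rightarrow> (real \<Rightarrow> complex) set" where
  "BL_splines k n r = {\<eta>.
     (\<forall>j\<in>{1..<n}. times_differentiable_on 4 \<eta> {r j<..<r (Suc j)} \<and>
        (\<forall>t\<in>{r j<..<r (Suc j)}. L_op k \<eta> t = 0)) \<and>
     times_differentiable_on 2 \<eta> {0<..<r 1} \<and> (\<forall>t\<in>{0<..<r 1}. G_op k \<eta> t = 0) \<and>
     times_differentiable_on 2 \<eta> {r n<..} \<and> (\<forall>t\<in>{r n<..}. R_op k \<eta> t = 0) \<and>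
     (\<forall>j\<in>{1..n}. C2_at \<eta> (r j)) \<and>
     \<eta> 0 = 0}"

definition phi :: "int \<Rightarrow> real \<Rightarrow> real" where
  "phi k r =
     (if r \<le> 1
      then 1 / 2 * r powi \<bar>k\<bar> * ((1 + of_int \<bar>k\<bar>) + (1 - of_int \<bar>k\<bar>) * r ^ 2)
      else 1 / 2 * r powi (- \<bar>k\<bar>) * ((1 - of_int \<bar>k\<bar>) + (1 + of_int \<bar>k\<bar>) * r ^ 2))"

end

theory Submission
  imports Defs
begin

text \<open>
  With \<open>m = \<bar>k\<bar> \<ge> 2\<close>, the equations \<open>L\<^sub>k \<eta> = 0\<close>, \<open>G\<^sub>k \<eta> = 0\<close>, \<open>R\<^sub>k \<eta> = 0\<close> are Euler equations with the
  distinct exponents \<open>{m, m + 2, - m, 2 - m}\<close>, \<open>{m, m + 2}\<close> and \<open>{- m, 2 - m}\<close>. So a spline is given on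
  each knot interval by four coefficients. A \<open>C\<^sup>2\<close> gluing at a knot \<open>\<rho>\<close> allows only a one-dimensional
  jump of the coefficient vector, which is exactly the jump of \<open>\<phi>\<^sub>k(\<cdot> / \<rho>)\<close>; this determines the \<open>a\<^sub>j\<close>.
  The coefficients of \<open>t\<^sup>-\<^sup>m, t\<^sup>2\<^sup>-\<^sup>m\<close> vanish near \<open>0\<close> and those of \<open>t\<^sup>m, t\<^sup>m\<^sup>+\<^sup>2\<close> vanish near \<open>\<infinity>\<close>, for the
  spline as well as for the \<open>\<phi>\<^sub>k(\<cdot> / r\<^sub>j)\<close>, so summing the jumps recovers the spline.
\<close>

section \<open>Sums of integer powers and Euler equations\<close>

text \<open>The index \<open>i\<close> counts derivatives.\<close>

definition powsum :: "nat \<Rightarrow> int set \<Rightarrow> (int \<Rightarrow> complex) \<Rightarrow> real \<Rightarrow> complex" where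
  "powsum i S c t =
     (\<Sum>s\<in>S. c s * (\<Prod>l<i. of_int s - of_nat l) * complex_of_real (t powi (s - int i)))"

lemma powsum_0: "powsum 0 S c t = (\<Sum>s\<in>S. c s * complex_of_real (t powi s))"
  by (simp add: powsum_def)

lemma powsum_has_vector_derivative:
  assumes "t > 0"
  shows "(powsum i S c has_vector_derivative powsum (Suc i) S c t) (at t)"
proof -
  have "((\<lambda>x. complex_of_real (x powi u)) has_vector_derivative
          complex_of_real (of_int u * t powi (u - 1))) (at t)" for u
  proof -
    have "((\<lambda>x. x powi u) has_real_derivative of_int u * t powi (u - 1)) (at t)"
      using assms by (auto intro!: derivative_eq_intros)
    then show ?thesis
      by (intro has_vector_derivative_of_real)
  qed
  from has_vector_derivative_mult_right[OF this]
  have "((\<lambda>x. c s * (\<Prod>l<i. of_int s - of_nat l) * complex_of_real (x powi (s - int i)))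
      has_vector_derivative
      c s * (\<Prod>l<Suc i. of_int s - of_nat l) * complex_of_real (t powi (s - int (Suc i)))) (at t)" for s
    by (rule has_vector_derivative_eq_rhs) (simp add: algebra_simps)
  then show ?thesis
    unfolding powsum_def by (rule has_vector_derivative_sum)
qed

text \<open>With \<theta> = t d/dt the equation reads (\<theta> - s) g = right side. As s is not in
  \<open>S\<close>, there is no resonance: dividing each coefficient by u - s gives a particular
  solution, and what remains is a multiple of t^s.\<close>

lemma euler_first_order:
  fixes g g' :: "real \<Rightarrow> complex"
  assumes S: "finite S" "s \<notin> S" and U: "convex U" "U \<subseteq> {0<..}"
    and g: "\<And>t. t \<in> U \<Longrightarrow> (g has_vector_derivative g' t) (at t)"
    and eq: "\<And>t. t \<in> U \<Longrightarrow> of_real t * g' t - of_int s * g t = powsum 0 S c t"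
  shows "\<exists>c'. \<forall>t\<in>U. g t = powsum 0 (insert s S) c' t"
proof -
  define d where "d = (\<lambda>u::int. c u / (of_int u - of_int s))"
  have d: "of_real t * powsum 1 S d t - of_int s * powsum 0 S d t = powsum 0 S c t" if "t > 0" for t
  proof -
    have "of_real t * (d u * (\<Prod>l<1. of_int u - of_nat l) * of_real (t powi (u - int 1)))
        - of_int s * (d u * (\<Prod>l<0. of_int u - of_nat l) * of_real (t powi (u - int 0)))
        = c u * (\<Prod>l<0. of_int u - of_nat l) * of_real (t powi (u - int 0))" if "u \<in> S" for u
    proof -
      have "complex_of_int u - of_int s \<noteq> 0" using that S by auto
      moreover have "t powi (u - 1) = t powi u / t"
        using \<open>t > 0\<close> by (simp add: power_int_diff)
      moreover have "d u * (of_int u - of_int s) = c u"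
        using calculation(1) by (simp add: d_def)
      ultimately show ?thesis
        using \<open>t > 0\<close> by (simp add: algebra_simps flip: \<open>_ = c u\<close>)
    qed
    then show ?thesis
      unfolding powsum_def by (simp add: sum_distrib_left sum_subtractf [symmetric])
  qed
  \<comment> \<open>The factor \<open>powsum 0 {-s} (\<lambda>_. 1)\<close> is t^(-s), an
    integrating factor, so \<open>h\<close> is constant on the convex set \<open>U\<close>.\<close>
  define h where "h = (\<lambda>t. powsum 0 {-s} (\<lambda>_. 1) t * (g t - powsum 0 S d t))"
  have "(h has_vector_derivative 0) (at t within U)" if "t \<in> U" for t
  proof -
    have t: "t > 0" using that U by auto
    have "(h has_vector_derivative powsum 0 {-s} (\<lambda>_. 1) t * (g' t - powsum (Suc 0) S d t)
           + powsum (Suc 0) {-s} (\<lambda>_. 1) t * (g t - powsum 0 S d t)) (at t)"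
      unfolding h_def using t that
      by (intro has_vector_derivative_mult has_vector_derivative_diff powsum_has_vector_derivative g)
    moreover have "powsum (Suc 0) {-s} (\<lambda>_. 1) t = - of_int s * powsum 0 {-s} (\<lambda>_. 1) t / of_real t"
      using t by (simp add: powsum_def power_int_diff)
    moreover have "g' t = (of_int s * g t + powsum 0 S c t) / of_real t"
      using eq[OF that] t by (simp add: field_simps)
    moreover have "powsum (Suc 0) S d t = (of_int s * powsum 0 S d t + powsum 0 S c t) / of_real t"
      using d[OF t] t by (simp add: field_simps)
    ultimately have "(h has_vector_derivative 0) (at t)"
      using t by (simp add: field_simps)
    then show ?thesis by (rule has_vector_derivative_at_within)
  qed
  then obtain K where K: "h t = K" if "t \<in> U" for t
    using has_vector_derivative_zero_constant[OF U(1)] by metis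
  have "g t = powsum 0 (insert s S) (d(s := K)) t" if "t \<in> U" for t
  proof -
    have t: "t > 0" using that U by auto
    have "g t - powsum 0 S d t = K * of_real (t powi s)"
      using K[OF that] t by (simp add: h_def powsum_0 power_int_minus field_simps)
    moreover have "powsum 0 S (d(s := K)) t = powsum 0 S d t"
      unfolding powsum_0 using S by (intro sum.cong) auto
    ultimately show ?thesis
      using S by (simp add: powsum_0 algebra_simps)
  qed
  then show ?thesis by blast
qed

text \<open>The left side is (\<theta> - s2)(\<theta> - s1) f for \<theta> = t d/dt, so the
  first-order case applies twice: to (\<theta> - s1) f, which gains the exponent s2, and then to f,
  which gains s1.\<close>

lemma euler_second_order:
  fixes f f' f'' :: "real \<Rightarrow> complex"
  assumes S: "finite S" "s1 \<notin> S" "s2 \<notin> S" "s1 \<noteq> s2" and U: "convex U" "U \<subseteq> {0<..}"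
    and f: "\<And>t. t \<in> U \<Longrightarrow> (f has_vector_derivative f' t) (at t)"
    and f': "\<And>t. t \<in> U \<Longrightarrow> (f' has_vector_derivative f'' t) (at t)"
    and eq: "\<And>t. t \<in> U \<Longrightarrow> of_real t ^ 2 * f'' t + (1 - of_int s1 - of_int s2) * of_real t * f' t
                 + of_int s1 * of_int s2 * f t = powsum 0 S c t"
  shows "\<exists>c'. \<forall>t\<in>U. f t = powsum 0 (insert s1 (insert s2 S)) c' t"
proof -
  have A: "((\<lambda>t. of_real t * f' t - of_int s1 * f t) has_vector_derivative
           of_real t * f'' t + f' t - of_int s1 * f' t) (at t)" if "t \<in> U" for t
  proof -
    have "(complex_of_real has_vector_derivative of_real 1) (at t)"
      by (rule has_vector_derivative_of_real[OF DERIV_ident])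
    from has_vector_derivative_diff[OF has_vector_derivative_mult[OF this f'[OF that]]
        has_vector_derivative_mult_right[OF f[OF that]]]
    show ?thesis by simp
  qed
  have B: "of_real t * (of_real t * f'' t + f' t - of_int s1 * f' t)
       - of_int s2 * (of_real t * f' t - of_int s1 * f t) = powsum 0 S c t" if "t \<in> U" for t
    using eq[OF that] by (simp add: algebra_simps power2_eq_square)
  obtain c' where c': "\<forall>t\<in>U. of_real t * f' t - of_int s1 * f t = powsum 0 (insert s2 S) c' t"
    using euler_first_order[where g = "\<lambda>t. of_real t * f' t - of_int s1 * f t" and c = c
        and g' = "\<lambda>t. of_real t * f'' t + f' t - of_int s1 * f' t", OF S(1,3) U A B] by blast
  have S': "finite (insert s2 S)" "s1 \<notin> insert s2 S"
    using S by auto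
  show ?thesis
    by (rule euler_first_order[where g = f and g' = f' and c = c', OF S' U f]) (use c' in auto)
qed

section \<open>Derivatives, linear independence and limits of power sums\<close>

lemma nderiv_0 [simp]: "nderiv 0 f = f"
  and nderiv_Suc: "nderiv (Suc i) f t = vector_derivative (nderiv i f) (at t)"
  by (simp_all add: nderiv_def)

lemma nderiv_has_vector_derivative:
  assumes "times_differentiable_on m f U" "i < m" "t \<in> U"
  shows "(nderiv i f has_vector_derivative nderiv (Suc i) f t) (at t)"
  using assms by (simp add: times_differentiable_on_def nderiv_Suc vector_derivative_works)

lemma nderiv_eq_powsum:
  assumes U: "open U" "U \<subseteq> {0<..}" and f: "\<And>t. t \<in> U \<Longrightarrow> f t = powsum 0 S c t" and "t \<in> U"
  shows "nderiv i f t = powsum i S c t"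
  using \<open>t \<in> U\<close>
proof (induction i arbitrary: t)
  case 0
  then show ?case by (simp add: f)
next
  case (Suc i)
  have "(powsum i S c has_vector_derivative powsum (Suc i) S c t) (at t)"
    using Suc.prems U by (intro powsum_has_vector_derivative) auto
  then have "(nderiv i f has_vector_derivative powsum (Suc i) S c t) (at t)"
    by (rule has_vector_derivative_transform_within_open[OF _ U(1) Suc.prems]) (simp add: Suc.IH)
  then show ?case by (simp add: nderiv_Suc vector_derivative_at)
qed

text \<open>Applying \<theta> - u with \<theta> = t d/dt removes t^u and multiplies every other
  coefficient by s - u, which is nonzero; this drives an induction on \<open>S\<close>.\<close>

lemma powsum_independent:
  assumes "finite S" "0 \<le> a" "a < b" "\<And>t. t \<in> {a<..<b} \<Longrightarrow> powsum 0 S c t = 0"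
  shows "\<forall>s\<in>S. c s = 0"
  using assms(1,4)
proof (induction S arbitrary: c rule: finite_induct)
  case empty
  then show ?case by simp
next
  case (insert u S)
  have *: "powsum 0 S (\<lambda>s. c s * (of_int s - of_int u)) t = 0" if t: "t \<in> {a<..<b}" for t
  proof -
    have "t > 0" using t assms by auto
    have "powsum i (insert u S) c t = nderiv i (\<lambda>_. 0) t" for i
    proof (rule nderiv_eq_powsum[of "{a<..<b}", symmetric])
      show "{a<..<b} \<subseteq> {0<..}" using \<open>0 \<le> a\<close> by auto
      show "0 = powsum 0 (insert u S) c x" if "x \<in> {a<..<b}" for x
        using insert.prems[OF that] by simp
    qed (use t in simp_all)
    moreover have "nderiv 1 (\<lambda>_. 0) t = 0" by (simp add: nderiv_Suc)
    ultimately have "of_real t * powsum 1 (insert u S) c t - of_int u * powsum 0 (insert u S) c t = 0"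
      by simp
    moreover have "of_real t * powsum 1 (insert u S) c t - of_int u * powsum 0 (insert u S) c t
       = powsum 0 (insert u S) (\<lambda>s. c s * (of_int s - of_int u)) t"
      using \<open>t > 0\<close> unfolding powsum_def sum_distrib_left sum_subtractf [symmetric]
      by (intro sum.cong) (auto simp: power_int_diff field_simps)
    ultimately show ?thesis using insert.hyps by (simp add: powsum_0)
  qed
  have S: "c s = 0" if "s \<in> S" for s
    using insert.IH[OF *] insert.hyps that by auto
  \<comment> \<open>Only the term with t^u is left, so one sample point suffices.\<close>
  have "powsum 0 (insert u S) c ((a + b) / 2) = 0"
    using assms by (intro insert.prems) auto
  moreover have "powsum 0 S c ((a + b) / 2) = 0"
    unfolding powsum_0 using S by (intro sum.neutral) auto
  ultimately have "c u * of_real (((a + b) / 2) powi u) = 0"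
    using insert.hyps by (simp add: powsum_0)
  moreover have "((a + b) / 2) powi u \<noteq> 0" using assms by simp
  ultimately have "c u = 0" by (simp only: mult_eq_0_iff of_real_eq_0_iff simp_thms)
  then show ?case using S by simp
qed

text \<open>On \<open>U\<close> the derivatives of f are those of the power sum. Both are continuous
  at \<rho>, an accumulation point of \<open>U\<close>, so they agree there. With \<open>U\<close>
  on one side of a knot this is one-sided matching.\<close>

lemma C2_at_powsum_limit:
  assumes "C2_at f \<rho>" "\<rho> > 0" and U: "open U" "U \<subseteq> {0<..}" "\<rho> islimpt U"
    and f: "\<And>t. t \<in> U \<Longrightarrow> f t = powsum 0 S c t" and "i \<le> 2"
  shows "nderiv i f \<rho> = powsum i S c \<rho>"
proof -
  obtain e where e: "e > 0" "C_on 2 f (ball \<rho> e)"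
    using assms by (auto simp: C2_at_def)
  have "isCont (nderiv i f) \<rho>"
  \<comment> \<open>Orders 0 and 1 are continuous because they are differentiable; order 2 is
    continuous by \<open>C_on\<close>.\<close>
  proof (cases "i = 2")
    case True
    then show ?thesis
      using e continuous_on_eq_continuous_at[of "ball \<rho> e" "nderiv 2 f"]
      by (simp add: C_on_def)
  next
    case False
    then show ?thesis
      using e \<open>i \<le> 2\<close>
      by (intro differentiable_imp_continuous_within) (auto simp: C_on_def times_differentiable_on_def)
  qed
  then have 1: "(nderiv i f \<longlongrightarrow> nderiv i f \<rho>) (at \<rho> within U)"
    by (auto simp: isCont_def intro: tendsto_within_subset)
  have "isCont (powsum i S c) \<rho>"
    using powsum_has_vector_derivative[OF \<open>\<rho> > 0\<close>] has_vector_derivative_continuous by blast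
  then have "(powsum i S c \<longlongrightarrow> powsum i S c \<rho>) (at \<rho> within U)"
    by (auto simp: isCont_def intro: tendsto_within_subset)
  then have "(nderiv i f \<longlongrightarrow> powsum i S c \<rho>) (at \<rho> within U)"
    by (rule Lim_transform_eventually)
      (auto simp: eventually_at_filter nderiv_eq_powsum[OF U(1,2) f])
  with 1 show ?thesis
    using U(3) by (intro tendsto_unique) (auto simp: trivial_limit_within)
qed

section \<open>The four exponents and the jump of \<open>phi\<close> at a knot\<close>

definition exponents :: "int \<Rightarrow> int set" where
  "exponents m = {m, m + 2, - m, 2 - m}"

text \<open>At m = 1 the exponents m and 2 - m coincide and a logarithmic solution appears; the
  bound m \<ge> 2 keeps four different powers.\<close>

lemma exponents_distinct:
  fixes m :: int
  assumes "m \<ge> 2"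
  shows "m \<noteq> m + 2" "m \<noteq> - m" "m \<noteq> 2 - m" "m + 2 \<noteq> - m" "m + 2 \<noteq> 2 - m" "- m \<noteq> 2 - m"
  using assms by auto

lemma finite_exponents [simp]: "finite (exponents m)"
  by (simp add: exponents_def)

text \<open>The jump at \<open>1\<close> of the coefficients of \<^const>\<open>phi\<close>.\<close>

definition jump_weight :: "int \<Rightarrow> int \<Rightarrow> complex" where
  "jump_weight m s =
     (if s = m then - (1 + of_int m) else if s = m + 2 then of_int m - 1
      else if s = - m then 1 - of_int m else 1 + of_int m) / 2"

text \<open>Each exponent occurs on one side of \<rho> only. The minus sign below \<rho> makes the
  coefficients above minus those below equal to the weights times \<rho>^(-s) for all four
  exponents.\<close>

lemma phi_eq_powsum:
  fixes k t \<rho>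
  defines "m \<equiv> \<bar>k\<bar>"
  assumes "t > 0" "\<rho> > 0" "m \<ge> 2"
  shows "complex_of_real (phi k (t / \<rho>)) =
    (if t \<le> \<rho> then - powsum 0 {m, m + 2} (\<lambda>s. jump_weight m s * of_real (\<rho> powi - s)) t
     else powsum 0 {- m, 2 - m} (\<lambda>s. jump_weight m s * of_real (\<rho> powi - s)) t)"
proof -
  \<comment> \<open>Naming the two powers turns the claim into identities of rational functions in
    p, q, t and \<rho>.\<close>
  define p q where "p = t powi m" and "q = \<rho> powi m"
  have pq: "p > 0" "q > 0" using assms by (auto simp: p_def q_def)
  have t: "t powi m = p" "t powi (m + 2) = p * t\<^sup>2" "t powi - m = 1 / p" "t powi (2 - m) = t\<^sup>2 / p"
    and \<rho>: "\<rho> powi - m = 1 / q" "\<rho> powi - (m + 2) = 1 / (q * \<rho>\<^sup>2)" "\<rho> powi - (- m) = q"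
      "\<rho> powi - (2 - m) = q / \<rho>\<^sup>2"
    and t\<rho>: "(t / \<rho>) powi m = p / q" "(t / \<rho>) powi - m = q / p"
    using assms(2,3)
    by (simp_all add: p_def q_def power_int_add power_int_diff power_int_minus_divide
        power_int_divide_distrib del: minus_diff_eq minus_add_distrib)
  note dist = exponents_distinct[OF assms(4)]
  have w: "jump_weight m m = of_real (- (1 + m) / 2)" "jump_weight m (m + 2) = of_real ((m - 1) / 2)"
    "jump_weight m (- m) = of_real ((1 - m) / 2)" "jump_weight m (2 - m) = of_real ((1 + m) / 2)"
    using dist by (auto simp: jump_weight_def)
  show ?thesis
  proof (cases "t \<le> \<rho>")
    case True
    have "phi k (t / \<rho>) = - (- (1 + m) / 2 * (1 / q) * p + (m - 1) / 2 * (1 / (q * \<rho>\<^sup>2)) * (p * t\<^sup>2))"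
      using assms(2,3) pq True unfolding phi_def m_def[symmetric] t\<rho> by (simp add: field_simps)
    moreover have "- powsum 0 {m, m + 2} (\<lambda>s. jump_weight m s * of_real (\<rho> powi - s)) t
       = complex_of_real (- (- (1 + m) / 2 * (1 / q) * p + (m - 1) / 2 * (1 / (q * \<rho>\<^sup>2)) * (p * t\<^sup>2)))"
      using dist unfolding powsum_0 by (simp only: sum.insert finite.intros insert_iff empty_iff sum.empty
          t \<rho> w simp_thms add_0_right of_real_mult of_real_add of_real_minus)
    ultimately show ?thesis using True by simp
  next
    case False
    have "phi k (t / \<rho>) = (1 - m) / 2 * q * (1 / p) + (1 + m) / 2 * (q / \<rho>\<^sup>2) * (t\<^sup>2 / p)"
      using assms(2,3) pq False unfolding phi_def m_def[symmetric] t\<rho> by (simp add: field_simps)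
    moreover have "powsum 0 {- m, 2 - m} (\<lambda>s. jump_weight m s * of_real (\<rho> powi - s)) t
       = complex_of_real ((1 - m) / 2 * q * (1 / p) + (1 + m) / 2 * (q / \<rho>\<^sup>2) * (t\<^sup>2 / p))"
      using dist unfolding powsum_0 by (simp only: sum.insert finite.intros insert_iff empty_iff sum.empty
          t \<rho> w simp_thms add_0_right of_real_mult of_real_add of_real_minus)
    ultimately show ?thesis using False by simp
  qed
qed

text \<open>Orders 0, 1 and 2 give three independent linear equations for four unknowns. Their
  solution space is a line, spanned by the jump of \<open>phi\<close>.\<close>

lemma jump_multiple:
  assumes "m \<ge> 2" "\<rho> > 0"
    and d: "\<And>i. i \<le> 2 \<Longrightarrow> powsum i (exponents m) d \<rho> = 0"
  shows "\<exists>a. \<forall>s\<in>exponents m. d s = a * (jump_weight m s * of_real (\<rho> powi - s))"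
proof -
  \<comment> \<open>This scaling removes \<rho> from the system: only falling factorials of the
    exponents remain as coefficients.\<close>
  define x where "x = (\<lambda>s. d s * complex_of_real (\<rho> powi s))"
  note dist = exponents_distinct[OF \<open>m \<ge> 2\<close>]
  define M where "M = complex_of_int m"
  have e: "of_real \<rho> ^ i * powsum i (exponents m) d \<rho>
     = (\<Sum>s\<in>exponents m. (\<Prod>l<i. of_int s - of_nat l) * x s)" for i
    unfolding powsum_def sum_distrib_left using \<open>\<rho> > 0\<close>
    by (intro sum.cong) (auto simp: x_def power_int_diff)
  have E0: "x m + x (m + 2) + x (- m) + x (2 - m) = 0"
    using e[of 0] d[of 0] dist by (simp add: exponents_def add.assoc)
  have E1: "M * x m + (M + 2) * x (m + 2) + (- M) * x (- m) + (2 - M) * x (2 - m) = 0"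
    using e[of 1] d[of 1] dist by (simp add: exponents_def M_def algebra_simps)
  have E2: "M * (M - 1) * x m + (M + 2) * (M + 1) * x (m + 2) + (- M) * (- M - 1) * x (- m)
       + (2 - M) * (1 - M) * x (2 - m) = 0"
    using e[of 2] d[of 2] dist by (simp add: exponents_def M_def lessThan_Suc numeral_2_eq_2 algebra_simps)
  text \<open>Each combination corresponds to a quadratic in \<open>s\<close> with roots at two of the four exponents.\<close>
  have eqs: "4 * M * (x m + x (2 - m)) = 0"
      "4 * ((M + 1) * x (m + 2) - (M - 1) * x (2 - m)) = 0"
      "4 * M * ((M + 1) * x (- m) + (M - 1) * x (2 - m)) = 0"
  proof -
    \<comment> \<open>With free e0, e1, e2 these are polynomial identities; the vanishing of the
      three derivatives enters only when 0 is put for each.\<close>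
    have *: "4 * M * (x1 + x4) = - (e2 - e1 - M * (M + 2) * e0)"
        "4 * ((M + 1) * x2 - (M - 1) * x4) = e2 + e1 - M * M * e0"
        "4 * M * ((M + 1) * x3 + (M - 1) * x4) = e2 - (2 * M + 1) * e1 + M * (M + 2) * e0"
      if "e0 = x1 + x2 + x3 + x4" "e1 = M * x1 + (M + 2) * x2 + (- M) * x3 + (2 - M) * x4"
        "e2 = M * (M - 1) * x1 + (M + 2) * (M + 1) * x2 + (- M) * (- M - 1) * x3
          + (2 - M) * (1 - M) * x4"
      for x1 x2 x3 x4 e0 e1 e2 :: complex
      unfolding that by (simp_all add: algebra_simps)
    show "4 * M * (x m + x (2 - m)) = 0"
      "4 * ((M + 1) * x (m + 2) - (M - 1) * x (2 - m)) = 0"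
      "4 * M * ((M + 1) * x (- m) + (M - 1) * x (2 - m)) = 0"
      using *[of 0 "x m" "x (m + 2)" "x (- m)" "x (2 - m)" 0 0] E0 E1 E2 by auto
  qed
  have nz: "M \<noteq> 0" "M + 1 \<noteq> 0"
  proof -
    show "M \<noteq> 0" using \<open>m \<ge> 2\<close> by (simp add: M_def)
    have "M + 1 = of_int (m + 1)" by (simp add: M_def)
    then show "M + 1 \<noteq> 0" using \<open>m \<ge> 2\<close> by (simp only: of_int_eq_0_iff)
  qed
  \<comment> \<open>The weight of the exponent 2 - m is (1 + M) / 2, so this value of a is forced by
    x (2 - m).\<close>
  define a where "a = 2 * x (2 - m) / (M + 1)"
  have x4: "x (2 - m) = a * ((1 + M) / 2)"
    using nz by (simp add: a_def add.commute)
  have "x m = - x (2 - m)"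
    using eqs(1) nz(1) by (simp add: eq_neg_iff_add_eq_0)
  then have "x m = a * (- (1 + M) / 2)"
    by (simp add: x4 algebra_simps)
  moreover have "(M + 1) * x (m + 2) = (M - 1) * x (2 - m)"
    using eqs(2) by simp
  then have "(M + 1) * x (m + 2) = (M + 1) * (a * ((M - 1) / 2))"
    by (simp add: x4 algebra_simps)
  then have "x (m + 2) = a * ((M - 1) / 2)"
    using nz(2) by (simp only: mult_cancel_left simp_thms)
  moreover have "(M + 1) * x (- m) = (M + 1) * (a * ((1 - M) / 2))"
  proof -
    have "(M + 1) * x (- m) + (M - 1) * x (2 - m) = 0"
      using eqs(3) nz(1) by simp
    then have "(M + 1) * x (- m) = - ((M - 1) * x (2 - m))"
      by (simp only: eq_neg_iff_add_eq_0)
    also have "\<dots> = (M + 1) * (a * ((1 - M) / 2))"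
      by (simp add: x4 field_simps)
    finally show ?thesis .
  qed
  then have "x (- m) = a * ((1 - M) / 2)"
    using nz(2) by (simp only: mult_cancel_left simp_thms)
  ultimately have "x s = a * jump_weight m s" if "s \<in> exponents m" for s
    using that x4 dist by (auto simp: exponents_def jump_weight_def simp flip: M_def)
  moreover have "d s = x s * of_real (\<rho> powi - s)" for s
    using \<open>\<rho> > 0\<close> by (simp add: x_def power_int_minus)
  ultimately show ?thesis by (auto intro!: exI[of _ a])
qed

text \<open>Padding by zeros lets the two outer pieces of a spline, which use two exponents each,
  share the exponent set of the inner pieces.\<close>

lemma powsum_extend:
  assumes "finite T" "S \<subseteq> T"
  shows "powsum 0 T (\<lambda>s. if s \<in> S then c s else 0) t = powsum 0 S c t"
  unfolding powsum_0 using assms by (intro sum.mono_neutral_cong_right) auto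

section \<open>Solutions of the three differential equations\<close>

text \<open>With m = |k| and \<theta> = t d/dt, t^3 G_k = (\<theta> - m)(\<theta> - m - 2). The
  equation is homogeneous, hence the empty exponent set on the right.\<close>

lemma G_op_solution:
  assumes U: "convex U" "U \<subseteq> {0<..}" and f: "times_differentiable_on 2 f U"
    and eq: "\<And>t. t \<in> U \<Longrightarrow> G_op k f t = 0"
  shows "\<exists>c. \<forall>t\<in>U. f t = powsum 0 {\<bar>k\<bar>, \<bar>k\<bar> + 2} c t"
proof -
  define M where "M = complex_of_int \<bar>k\<bar>"
  have D: "(nderiv i f has_vector_derivative nderiv (Suc i) f t) (at t)" if "i < 2" "t \<in> U" for i t
    using nderiv_has_vector_derivative[OF f] that by blast
  have E: "of_real t ^ 2 * nderiv 2 f t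
      + (1 - of_int \<bar>k\<bar> - of_int (\<bar>k\<bar> + 2)) * of_real t * nderiv 1 f t
      + of_int \<bar>k\<bar> * of_int (\<bar>k\<bar> + 2) * f t = powsum 0 {} (\<lambda>_. 0) t" if "t \<in> U" for t
  proof -
    have t: "t > 0" using that U by auto
    have "nderiv 2 f t - (2 * M + 1) / of_real t * nderiv 1 f t
        + M * (M + 2) / of_real t ^ 2 * f t = 0" (is "?e = 0")
      using eq[OF that] t by (simp add: G_op_def M_def scaleR_conv_of_real del: of_int_abs)
    moreover have "of_real t ^ 2 * ?e = of_real t ^ 2 * nderiv 2 f t
        + (1 - M - (M + 2)) * of_real t * nderiv 1 f t + M * (M + 2) * f t"
      using t by (simp add: field_simps power2_eq_square)
    ultimately show ?thesis
      by (simp add: powsum_0 M_def)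
  qed
  show ?thesis
    by (rule euler_second_order[where f = f and f' = "nderiv 1 f" and f'' = "nderiv 2 f"
          and S = "{}" and c = "\<lambda>_. 0", OF _ _ _ _ U])
      (use D[of 0] D[of 1] E in \<open>simp_all add: numeral_2_eq_2\<close>)
qed

text \<open>With m = |k| and \<theta> = t d/dt, t^3 R_k = (\<theta> + m)(\<theta> + m - 2).\<close>

lemma R_op_solution:
  assumes U: "convex U" "U \<subseteq> {0<..}" and f: "times_differentiable_on 2 f U"
    and eq: "\<And>t. t \<in> U \<Longrightarrow> R_op k f t = 0"
  shows "\<exists>c. \<forall>t\<in>U. f t = powsum 0 {- \<bar>k\<bar>, 2 - \<bar>k\<bar>} c t"
proof -
  define M where "M = complex_of_int \<bar>k\<bar>"
  have D: "(nderiv i f has_vector_derivative nderiv (Suc i) f t) (at t)" if "i < 2" "t \<in> U" for i t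
    using nderiv_has_vector_derivative[OF f] that by blast
  have E: "of_real t ^ 2 * nderiv 2 f t
      + (1 - of_int (- \<bar>k\<bar>) - of_int (2 - \<bar>k\<bar>)) * of_real t * nderiv 1 f t
      + of_int (- \<bar>k\<bar>) * of_int (2 - \<bar>k\<bar>) * f t = powsum 0 {} (\<lambda>_. 0) t" if "t \<in> U" for t
  proof -
    have t: "t > 0" using that U by auto
    have "nderiv 2 f t + (2 * M - 1) / of_real t * nderiv 1 f t
        + M * (M - 2) / of_real t ^ 2 * f t = 0" (is "?e = 0")
      using eq[OF that] t by (simp add: R_op_def M_def scaleR_conv_of_real del: of_int_abs)
    moreover have "of_real t ^ 2 * ?e = of_real t ^ 2 * nderiv 2 f t
        + (1 + M - (2 - M)) * of_real t * nderiv 1 f t + - M * (2 - M) * f t"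
      using t by (simp add: field_simps power2_eq_square)
    ultimately show ?thesis
      by (simp add: powsum_0 M_def)
  qed
  show ?thesis
    by (rule euler_second_order[where f = f and f' = "nderiv 1 f" and f'' = "nderiv 2 f"
          and S = "{}" and c = "\<lambda>_. 0", OF _ _ _ _ U])
      (use D[of 0] D[of 1] E in \<open>simp_all add: numeral_2_eq_2\<close>)
qed

text \<open>The fourth-order equation splits into two second-order ones: a homogeneous equation for
  an auxiliary function with exponents m + 2 and 2 - m, then one for f with that function on the
  right side.\<close>

lemma L_op_solution:
  assumes "\<bar>k\<bar> \<ge> 2" and U: "convex U" "U \<subseteq> {0<..}" and f: "times_differentiable_on 4 f U"
    and eq: "\<And>t. t \<in> U \<Longrightarrow> L_op k f t = 0"
  shows "\<exists>c. \<forall>t\<in>U. f t = powsum 0 (exponents \<bar>k\<bar>) c t"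
proof -
  define m where "m = \<bar>k\<bar>"
  define M where "M = complex_of_int m"
  have k: "complex_of_int k ^ 2 = M ^ 2" "complex_of_int k ^ 4 = M ^ 4"
    by (simp_all add: M_def m_def flip: of_int_power)
  have D: "(nderiv i f has_vector_derivative nderiv (Suc i) f t) (at t)" if "i < 4" "t \<in> U" for i t
    using nderiv_has_vector_derivative[OF f] that by blast
  have D': "(f has_vector_derivative nderiv 1 f t) (at t)"
      "(nderiv 1 f has_vector_derivative nderiv 2 f t) (at t)"
      "(nderiv 2 f has_vector_derivative nderiv 3 f t) (at t)"
      "(nderiv 3 f has_vector_derivative nderiv 4 f t) (at t)" if "t \<in> U" for t
    using D[of 0] D[of 1] D[of 2] D[of 3] that by (simp_all add: eval_nat_numeral)
  have dt: "(complex_of_real has_vector_derivative 1) (at t)" for t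
    by (rule has_vector_derivative_eq_rhs[OF has_vector_derivative_of_real[OF DERIV_ident]]) simp
  note dt2 = has_vector_derivative_mult[OF dt dt]
  text \<open>\<open>t\<^sup>3 L\<^sub>k = ((\<theta> - 2)\<^sup>2 - m\<^sup>2) (\<theta>\<^sup>2 - m\<^sup>2)\<close> for \<open>\<theta> = t d/dt\<close>, and \<open>h = (\<theta>\<^sup>2 - m\<^sup>2) f\<close>.\<close>
  define h where "h = (\<lambda>t. of_real t * of_real t * nderiv 2 f t + of_real t * nderiv 1 f t - M ^ 2 * f t)"
  define h' where "h' = (\<lambda>t. of_real t ^ 2 * nderiv 3 f t + 3 * of_real t * nderiv 2 f t
      + (1 - M ^ 2) * nderiv 1 f t)"
  define h'' where "h'' = (\<lambda>t. of_real t ^ 2 * nderiv 4 f t + 5 * of_real t * nderiv 3 f t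
      + (4 - M ^ 2) * nderiv 2 f t)"
  have h: "(h has_vector_derivative h' t) (at t)" if "t \<in> U" for t
    unfolding h_def h'_def
    by (rule has_vector_derivative_eq_rhs[OF has_vector_derivative_diff[OF has_vector_derivative_add[OF
          has_vector_derivative_mult[OF dt2 D'(3)[OF that]]
          has_vector_derivative_mult[OF dt D'(2)[OF that]]]
          has_vector_derivative_mult_right[OF D'(1)[OF that]]]])
      (simp add: algebra_simps power2_eq_square)
  have h': "(h' has_vector_derivative h'' t) (at t)" if "t \<in> U" for t
    unfolding h'_def h''_def power2_eq_square[of "complex_of_real _"] mult.assoc[of 3]
    by (rule has_vector_derivative_eq_rhs[OF has_vector_derivative_add[OF has_vector_derivative_add[OF
          has_vector_derivative_mult[OF dt2 D'(4)[OF that]]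
          has_vector_derivative_mult_right[OF has_vector_derivative_mult[OF dt D'(3)[OF that]]]]
          has_vector_derivative_mult_right[OF D'(2)[OF that]]]])
      (simp add: algebra_simps)
  have Eh: "of_real t ^ 2 * h'' t + (1 - of_int (m + 2) - of_int (2 - m)) * of_real t * h' t
      + of_int (m + 2) * of_int (2 - m) * h t = powsum 0 {} (\<lambda>_. 0) t" if "t \<in> U" for t
  proof -
    define T where "T = complex_of_real t"
    have T: "T \<noteq> 0" using that U by (auto simp: T_def)
    have L: "L_op k f t = T * nderiv 4 f t + 2 * nderiv 3 f t - (2 * M ^ 2 + 1) / T * nderiv 2 f t
        + (2 * M ^ 2 + 1) / T ^ 2 * nderiv 1 f t + (M ^ 4 - 4 * M ^ 2) / T ^ 3 * f t"
      by (simp add: L_op_def scaleR_conv_of_real k flip: T_def)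
    have "T ^ 3 * L_op k f t = T ^ 4 * nderiv 4 f t + 2 * T ^ 3 * nderiv 3 f t
        - (2 * M ^ 2 + 1) * T ^ 2 * nderiv 2 f t + (2 * M ^ 2 + 1) * T * nderiv 1 f t
        + (M ^ 4 - 4 * M ^ 2) * f t"
      unfolding L using T by (simp add: field_simps eval_nat_numeral)
    also have "\<dots> = T ^ 2 * h'' t + (1 - (M + 2) - (2 - M)) * T * h' t + (M + 2) * (2 - M) * h t"
      unfolding h_def h'_def h''_def T_def[symmetric]
      by (simp add: algebra_simps eval_nat_numeral)
    finally show ?thesis
      using eq[OF that] by (simp add: powsum_0 M_def T_def)
  qed
  have "\<exists>c. \<forall>t\<in>U. h t = powsum 0 {m + 2, 2 - m} c t"
    by (rule euler_second_order[where f = h and f' = h' and f'' = h''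
          and S = "{}" and c = "\<lambda>_. 0", OF _ _ _ _ U])
      (use h h' Eh assms(1) in \<open>auto simp: m_def\<close>)
  then obtain c where c: "h t = powsum 0 {m + 2, 2 - m} c t" if "t \<in> U" for t
    by blast
  \<comment> \<open>The new exponents m and -m differ from m + 2 and 2 - m because m \<ge> 2, so no
    resonance occurs.\<close>
  have "\<exists>c. \<forall>t\<in>U. f t = powsum 0 (insert m (insert (- m) {m + 2, 2 - m})) c t"
  proof (rule euler_second_order[where f = f and f' = "nderiv 1 f" and f'' = "nderiv 2 f"
          and c = c, OF _ _ _ _ U D'(1,2)])
    show "of_real t ^ 2 * nderiv 2 f t + (1 - of_int m - of_int (- m)) * of_real t * nderiv 1 f t
      + of_int m * of_int (- m) * f t = powsum 0 {m + 2, 2 - m} c t" if "t \<in> U" for t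
      using c[OF that] by (simp add: h_def M_def power2_eq_square)
  qed (use assms(1) in \<open>auto simp: m_def\<close>)
  moreover have "insert m (insert (- m) {m + 2, 2 - m}) = exponents m"
    by (auto simp: exponents_def)
  ultimately show ?thesis by (simp add: m_def)
qed

section \<open>Gluing at a knot and the piecewise form of a spline\<close>

text \<open>The derivatives of f at \<rho> up to order 2 can be computed from either side. Hence
  those of the power sum with coefficients c' - c vanish at \<rho>, as \<open>jump_multiple\<close>
  requires.\<close>

lemma powsum_jump:
  assumes "m \<ge> 2" "0 \<le> a" "a < \<rho>" "\<rho> < b" "C2_at f \<rho>"
    and l: "\<And>t. t \<in> {a<..<\<rho>} \<Longrightarrow> f t = powsum 0 (exponents m) c t"
    and u: "\<And>t. t \<in> {\<rho><..<b} \<Longrightarrow> f t = powsum 0 (exponents m) c' t"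
  shows "f \<rho> = powsum 0 (exponents m) c \<rho>"
    and "\<exists>x. \<forall>s\<in>exponents m. c' s - c s = x * (jump_weight m s * of_real (\<rho> powi - s))"
proof -
  have "{a<..<\<rho>} \<subseteq> {0<..}" "\<rho> islimpt {a<..<\<rho>}"
    using assms(2,3) by (auto simp: islimpt_greaterThanLessThan2)
  from C2_at_powsum_limit[OF \<open>C2_at f \<rho>\<close> _ open_greaterThanLessThan this l]
  have 1: "nderiv i f \<rho> = powsum i (exponents m) c \<rho>" if "i \<le> 2" for i
    using assms that by simp
  from 1[of 0] show "f \<rho> = powsum 0 (exponents m) c \<rho>"
    by simp
  have "{\<rho><..<b} \<subseteq> {0<..}" "\<rho> islimpt {\<rho><..<b}"
    using assms(2-4) by (auto simp: islimpt_greaterThanLessThan1)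
  from C2_at_powsum_limit[OF \<open>C2_at f \<rho>\<close> _ open_greaterThanLessThan this u]
  have 2: "nderiv i f \<rho> = powsum i (exponents m) c' \<rho>" if "i \<le> 2" for i
    using assms that by simp
  have "powsum i (exponents m) (\<lambda>s. c' s - c s) \<rho>
      = powsum i (exponents m) c' \<rho> - powsum i (exponents m) c \<rho>" for i
    by (simp add: powsum_def algebra_simps sum_subtractf)
  then have "powsum i (exponents m) (\<lambda>s. c' s - c s) \<rho> = 0" if "i \<le> 2" for i
    using 1[OF that] 2[OF that] by simp
  then show "\<exists>x. \<forall>s\<in>exponents m. c' s - c s = x * (jump_weight m s * of_real (\<rho> powi - s))"
    using assms by (intro jump_multiple) auto
qed

text \<open>The guards merge the two unbounded or boundary pieces with the inner ones into a family
  indexed by 0, ..., n, without consulting \<open>r 0\<close> or \<open>r (Suc n)\<close>.\<close>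

definition knot_interval :: "nat \<Rightarrow> (nat \<Rightarrow> real) \<Rightarrow> nat \<Rightarrow> real set" where
  "knot_interval n r i = {t. 0 < t \<and> (0 < i \<longrightarrow> r i < t) \<and> (i < n \<longrightarrow> t < r (Suc i))}"

lemma BL_spline_piecewise:
  assumes "\<bar>k\<bar> \<ge> 2" "n \<ge> 1" "0 < r 1" "strict_mono_on {1..n} r" "\<sigma> \<in> BL_splines k n r"
  defines "m \<equiv> \<bar>k\<bar>"
  shows "\<exists>c. (\<forall>i\<le>n. \<forall>t\<in>knot_interval n r i. \<sigma> t = powsum 0 (exponents m) (c i) t) \<and>
             c 0 (- m) = 0 \<and> c 0 (2 - m) = 0 \<and> c n m = 0 \<and> c n (m + 2) = 0"
proof -
  note dist = exponents_distinct[OF assms(1), folded m_def]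
  have pos: "0 < r j" if "j \<in> {1..n}" for j
  proof -
    have "r 1 \<le> r j"
      using that by (intro strict_mono_on_leD[OF assms(4)]) auto
    then show ?thesis using assms(3) by simp
  qed
  \<comment> \<open>The end conditions are implications inside the claim for each i, so that a
    single choice of coefficients yields them too.\<close>
  have *: "\<exists>c. (\<forall>t\<in>knot_interval n r i. \<sigma> t = powsum 0 (exponents m) c t) \<and>
     (i = 0 \<longrightarrow> c (- m) = 0 \<and> c (2 - m) = 0) \<and> (i = n \<longrightarrow> c m = 0 \<and> c (m + 2) = 0)" if "i \<le> n" for i
  proof -
    consider "i = 0" | "i = n" "i > 0" | "i \<in> {1..<n}"
      using \<open>i \<le> n\<close> by fastforce
    then show ?thesis
    proof cases
      case 1
      have I: "knot_interval n r i = {0<..<r 1}"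
        using assms 1 by (auto simp: knot_interval_def)
      have sub: "{0<..<r 1} \<subseteq> {0<..}" by auto
      obtain c where c: "\<forall>t\<in>{0<..<r 1}. \<sigma> t = powsum 0 {m, m + 2} c t"
        using G_op_solution[of "{0<..<r 1}" \<sigma> k, OF _ sub] assms(5) by (auto simp: BL_splines_def m_def)
      define c' where "c' = (\<lambda>s. if s \<in> {m, m + 2} then c s else 0)"
      have "powsum 0 (exponents m) c' t = powsum 0 {m, m + 2} c t" for t
        unfolding c'_def by (rule powsum_extend) (auto simp: exponents_def)
      moreover have "c' (- m) = 0" "c' (2 - m) = 0"
        using dist by (auto simp: c'_def)
      \<comment> \<open>The clause for i = n is vacuous here since n \<ge> 1.\<close>
      ultimately show ?thesis
        using c 1 assms(2) unfolding I by (intro exI[of _ c']) simp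
    next
      case 2
      have I: "knot_interval n r i = {r n<..}"
        using pos[of n] 2 by (auto simp: knot_interval_def)
      have sub: "{r n<..} \<subseteq> {0<..}" using pos[of n] 2 by auto
      obtain c where c: "\<forall>t\<in>{r n<..}. \<sigma> t = powsum 0 {- m, 2 - m} c t"
        using R_op_solution[of "{r n<..}" \<sigma> k, OF _ sub] assms(5) by (auto simp: BL_splines_def m_def)
      define c' where "c' = (\<lambda>s. if s \<in> {- m, 2 - m} then c s else 0)"
      have "powsum 0 (exponents m) c' t = powsum 0 {- m, 2 - m} c t" for t
        unfolding c'_def by (rule powsum_extend) (auto simp: exponents_def)
      moreover have "c' m = 0" "c' (m + 2) = 0"
        using dist by (auto simp: c'_def)
      ultimately show ?thesis
        using c 2 unfolding I by (intro exI[of _ c']) simp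
    next
      case 3
      have I: "knot_interval n r i = {r i<..<r (Suc i)}"
        using pos[of i] 3 by (auto simp: knot_interval_def)
      have sub: "{r i<..<r (Suc i)} \<subseteq> {0<..}" using pos[of i] 3 by auto
      show ?thesis
        unfolding I using L_op_solution[OF assms(1) _ sub, of \<sigma>] assms(5) 3
        by (auto simp: BL_splines_def m_def)
    qed
  qed
  then have "\<exists>c. \<forall>i\<le>n. (\<forall>t\<in>knot_interval n r i. \<sigma> t = powsum 0 (exponents m) (c i) t) \<and>
     (i = 0 \<longrightarrow> c i (- m) = 0 \<and> c i (2 - m) = 0) \<and> (i = n \<longrightarrow> c i m = 0 \<and> c i (m + 2) = 0)"
    by (intro choice_iff'[THEN iffD1]) blast
  then show ?thesis by (elim ex_forward) auto
qed

section \<open>Coefficients of combinations of the functions \<open>phi k (t / r j)\<close>\<close>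

text \<open>The knots up to index i lie strictly below t and contribute the exponents -m and 2 - m;
  the others contribute m and m + 2, with a minus sign. A knot equal to t belongs to the second
  group, as \<open>phi\<close> takes its first branch at 1.\<close>

lemma sum_phi_eq_powsum:
  fixes k :: int and a :: "nat \<Rightarrow> complex"
  defines "m \<equiv> \<bar>k\<bar>"
  assumes "m \<ge> 2" "t > 0" "i \<le> n" and pos: "\<And>j. j \<in> {1..n} \<Longrightarrow> r j > 0"
    and l: "\<And>j. j \<in> {1..i} \<Longrightarrow> r j < t" and u: "\<And>j. j \<in> {i<..n} \<Longrightarrow> t \<le> r j"
  defines "J \<equiv> \<lambda>j s. a j * (jump_weight m s * of_real (r j powi - s))"
  shows "(\<Sum>j = 1..n. a j * complex_of_real (phi k (t / r j)))
       = powsum 0 (exponents m)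
           (\<lambda>s. if s \<in> {- m, 2 - m} then \<Sum>j = 1..i. J j s else - (\<Sum>j\<in>{i<..n}. J j s)) t"
proof -
  note dist = exponents_distinct[OF \<open>m \<ge> 2\<close>]
  have J: "a j * powsum 0 S (\<lambda>s. jump_weight m s * of_real (r j powi - s)) t = powsum 0 S (J j) t" for j S
    by (simp add: powsum_0 J_def sum_distrib_left mult.assoc)
  have swap: "(\<Sum>j\<in>A. powsum 0 S (J j) t) = powsum 0 S (\<lambda>s. \<Sum>j\<in>A. J j s) t" for A S
    unfolding powsum_0 sum_distrib_right by (rule sum.swap)
  have "{1..n} = {1..i} \<union> {i<..n}" using \<open>i \<le> n\<close> by auto
  then have "(\<Sum>j = 1..n. a j * complex_of_real (phi k (t / r j)))
      = (\<Sum>j = 1..i. a j * complex_of_real (phi k (t / r j)))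
        + (\<Sum>j\<in>{i<..n}. a j * complex_of_real (phi k (t / r j)))"
    by (simp add: sum.union_disjoint disjoint_iff)
  also have "(\<Sum>j = 1..i. a j * complex_of_real (phi k (t / r j)))
      = (\<Sum>j = 1..i. powsum 0 {- m, 2 - m} (J j) t)"
  proof (rule sum.cong)
    fix j assume j: "j \<in> {1..i}"
    have "r j > 0" using j \<open>i \<le> n\<close> by (intro pos) auto
    then show "a j * complex_of_real (phi k (t / r j)) = powsum 0 {- m, 2 - m} (J j) t"
      using phi_eq_powsum[of t "r j" k] l[OF j] assms(2,3) by (simp add: J del: of_real_power_int flip: m_def)
  qed simp
  also have "(\<Sum>j\<in>{i<..n}. a j * complex_of_real (phi k (t / r j)))
      = - (\<Sum>j\<in>{i<..n}. powsum 0 {m, m + 2} (J j) t)"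
    unfolding sum_negf [symmetric]
  proof (rule sum.cong)
    fix j assume j: "j \<in> {i<..n}"
    have "r j > 0" using j by (intro pos) auto
    then show "a j * complex_of_real (phi k (t / r j)) = - powsum 0 {m, m + 2} (J j) t"
      using phi_eq_powsum[of t "r j" k] u[OF j] assms(2,3) by (simp add: J del: of_real_power_int flip: m_def)
  qed simp
  finally show ?thesis
    unfolding swap using dist by (simp add: powsum_0 exponents_def)
qed

text \<open>Just to the right of \<open>r i\<close>, the coefficient of t^(2 - m) is the sum of the
  first i jumps. Independence makes each such partial sum vanish, and consecutive ones differ by a
  nonzero multiple of \<open>d i\<close>.\<close>

lemma sum_phi_eq_0_imp:
  fixes k :: int and d :: "nat \<Rightarrow> complex"
  assumes "\<bar>k\<bar> \<ge> 2" "0 < r 1" "strict_mono_on {1..n} r"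
    and d: "\<And>t. t > 0 \<Longrightarrow> (\<Sum>j = 1..n. d j * complex_of_real (phi k (t / r j))) = 0"
    and i: "i \<in> {1..n}"
  shows "d i = 0"
proof -
  define m where "m = \<bar>k\<bar>"
  have m: "m \<ge> 2" using assms(1) by (simp add: m_def)
  note dist = exponents_distinct[OF m]
  note mono = strict_mono_onD[OF assms(3)]
  have mono_le: "r i \<le> r j" if "i \<in> {1..n}" "j \<in> {1..n}" "i \<le> j" for i j
    using assms(3) that by (rule strict_mono_on_leD)
  have pos: "0 < r j" if "j \<in> {1..n}" for j
    using mono_le[of 1 j] that assms(2) by auto
  define J where "J = (\<lambda>j s. d j * (jump_weight m s * of_real (r j powi - s)))"
  have S: "(\<Sum>j = 1..i. J j (2 - m)) = 0" if "i \<le> n" for i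
  proof (cases "i = 0")
    case False
    \<comment> \<open>Past the last knot any larger endpoint would do; \<open>r n + 1\<close> is
      one.\<close>
    define hi where "hi = (if i = n then r n + 1 else r (Suc i))"
    have b: "0 < r i" "r i < hi"
      using False that pos[of i] mono[of i "Suc i"] by (auto simp: hi_def)
    have "powsum 0 (exponents m)
      (\<lambda>s. if s \<in> {- m, 2 - m} then \<Sum>j = 1..i. J j s else - (\<Sum>j\<in>{i<..n}. J j s)) t = 0"
      if t: "t \<in> {r i<..<hi}" for t
    proof -
      have "t > 0" using t b by auto
      moreover have "r j < t" if "j \<in> {1..i}" for j
        using mono_le[of j i] t that \<open>i \<le> n\<close> by auto
      moreover have "t \<le> r j" if "j \<in> {i<..n}" for j
        using mono_le[of "Suc i" j] t that by (auto simp: hi_def)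
      ultimately have "(\<Sum>j = 1..n. d j * complex_of_real (phi k (t / r j))) = powsum 0 (exponents m)
        (\<lambda>s. if s \<in> {- m, 2 - m} then \<Sum>j = 1..i. J j s else - (\<Sum>j\<in>{i<..n}. J j s)) t"
        unfolding J_def m_def
        by (intro sum_phi_eq_powsum) (use assms(1) pos \<open>i \<le> n\<close> in auto)
      then show ?thesis
        using d[OF \<open>t > 0\<close>] by simp
    qed
    from powsum_independent[OF finite_exponents less_imp_le[OF b(1)] b(2) this]
    show ?thesis by (auto simp: exponents_def)
  qed simp
  \<comment> \<open>For l = 0 the smaller partial sum is empty, which is why \<open>S\<close>
    includes the index 0.\<close>
  obtain l where "i = Suc l" using i by (cases i) auto
  then have "J i (2 - m) = 0"
    using S[of i] S[of l] i by simp
  moreover have "jump_weight m (2 - m) \<noteq> 0"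
  proof -
    have "jump_weight m (2 - m) = of_int (1 + m) / 2"
      using dist by (auto simp: jump_weight_def)
    moreover have "complex_of_int (1 + m) \<noteq> 0"
      using m by (simp only: of_int_eq_0_iff)
    ultimately show ?thesis by auto
  qed
  ultimately show "d i = 0"
    using pos[OF i] by (simp add: J_def)
qed

section \<open>Existence by telescoping jumps, uniqueness by independence\<close>

text \<open>Coefficients are functions on all naturals; extensionality fixes their values outside
  {1..n}, so that uniqueness concerns only the n genuine coefficients.\<close>

theorem theorem3:
  fixes k :: int and n :: nat and r :: "nat \<Rightarrow> real" and \<nu> :: "nat \<Rightarrow> real"
    and \<sigma> :: "real \<Rightarrow> complex"
  assumes "\<bar>k\<bar> \<ge> 2" and "n \<ge> 2"
    and "0 < r 1" and "strict_mono_on {1..n} r"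
    and "\<sigma> \<in> BL_splines k n r"
    and "\<forall>j\<in>{1..n}. \<sigma> (r j) = complex_of_real (\<nu> j)"
  shows "\<exists>!a. a \<in> {1..n} \<rightarrow>\<^sub>E (UNIV :: complex set) \<and>
           (\<forall>t\<ge>0. \<sigma> t = (\<Sum>j = 1..n. a j * complex_of_real (phi k (t / r j))))"
proof -
  define m where "m = \<bar>k\<bar>"
  have m: "m \<ge> 2" using assms(1) by (simp add: m_def)
  note mono = strict_mono_onD[OF assms(4)]
  have mono_le: "r i \<le> r j" if "i \<in> {1..n}" "j \<in> {1..n}" "i \<le> j" for i j
    using assms(4) that by (rule strict_mono_on_leD)
  have pos: "0 < r j" if "j \<in> {1..n}" for j
    using mono_le[of 1 j] that assms(3) by auto
  obtain c where c: "\<And>i t. i \<le> n \<Longrightarrow> t \<in> knot_interval n r i \<Longrightarrow> \<sigma> t = powsum 0 (exponents m) (c i) t"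
    and c0: "c 0 (- m) = 0" "c 0 (2 - m) = 0" and cn: "c n m = 0" "c n (m + 2) = 0"
    using BL_spline_piecewise[OF assms(1) _ assms(3-5)] assms(2) unfolding m_def by auto
  \<comment> \<open>Piece j - 1 lies to the left of knot j and piece j to the right. The first
    conjunct supplies the value at the knot itself, which no open piece contains.\<close>
  have jump: "\<sigma> (r j) = powsum 0 (exponents m) (c (j - 1)) (r j) \<and>
    (\<exists>x. \<forall>s\<in>exponents m. c j s - c (j - 1) s = x * (jump_weight m s * of_real (r j powi - s)))"
    if j: "j \<in> {1..n}" for j
  proof -
    define lo hi where "lo = (if j = 1 then 0 else r (j - 1))" and "hi = (if j = n then r n + 1 else r (Suc j))"
    have "0 \<le> lo \<and> lo < r j"
    proof (cases "j = 1")
      case False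
      then have "j - 1 \<in> {1..n}" "j - 1 < j" using j by auto
      with pos[of "j - 1"] mono[of "j - 1" j] j False show ?thesis
        by (auto simp: lo_def)
    qed (use assms(3) in \<open>simp add: lo_def\<close>)
    then have b: "0 \<le> lo" "lo < r j" "r j < hi"
      using j mono[of j "Suc j"] by (auto simp: hi_def)
    have "C2_at \<sigma> (r j)" using assms(5) j by (auto simp: BL_splines_def)
    moreover have "\<sigma> t = powsum 0 (exponents m) (c (j - 1)) t" if "t \<in> {lo<..<r j}" for t
      using that j b(1) by (intro c) (auto simp: knot_interval_def lo_def split: if_splits)
    moreover have "\<sigma> t = powsum 0 (exponents m) (c j) t" if "t \<in> {r j<..<hi}" for t
      using that j pos[OF j] by (intro c) (auto simp: knot_interval_def hi_def split: if_splits)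
    ultimately show ?thesis
      using powsum_jump[OF m b] by blast
  qed
  \<comment> \<open>The factors of the jumps are the coefficients sought.\<close>
  have "\<exists>a. \<forall>j\<in>{1..n}. \<forall>s\<in>exponents m. c j s - c (j - 1) s = a j * (jump_weight m s * of_real (r j powi - s))"
    using jump by (intro bchoice) blast
  then obtain a where a: "\<And>j s. j \<in> {1..n} \<Longrightarrow> s \<in> exponents m \<Longrightarrow>
      c j s - c (j - 1) s = a j * (jump_weight m s * of_real (r j powi - s))"
    by blast
  have rep: "\<sigma> t = (\<Sum>j = 1..n. a j * complex_of_real (phi k (t / r j)))" if "t \<ge> 0" for t
  proof (cases "t = 0")
    case True
    have "phi k 0 = 0" using m by (auto simp: phi_def m_def)
    then show ?thesis using True assms(5) by (simp add: BL_splines_def)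
  next
    case False
    then have "t > 0" using that by simp
    \<comment> \<open>The last knot strictly below t, or 0 if there is none. Strictness assigns a
      knot to the piece on its left, in agreement with the branches of \<open>phi\<close>.\<close>
    define i where "i = (GREATEST i. i \<le> n \<and> (i = 0 \<or> r i < t))"
    have i: "i \<le> n \<and> (i = 0 \<or> r i < t)"
      unfolding i_def by (rule GreatestI_nat[of _ 0 n]) auto
    have max: "j \<le> i" if "j \<le> n" "r j < t" for j
      unfolding i_def by (rule Greatest_le_nat[of _ _ n]) (use that in auto)
    have u: "t \<le> r j" if "j \<in> {i<..n}" for j
      using max[of j] that by force
    have l: "r j < t" if "j \<in> {1..i}" for j
      using mono_le[of j i] i that by auto
    have \<sigma>: "\<sigma> t = powsum 0 (exponents m) (c i) t"
    proof (cases "i < n \<and> t = r (Suc i)")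
      case True
      then show ?thesis using jump[of "Suc i"] by auto
    next
      case False
      then have "t \<in> knot_interval n r i"
        using \<open>t > 0\<close> i u[of "Suc i"] by (auto simp: knot_interval_def)
      then show ?thesis using c i by blast
    qed
    define J where "J = (\<lambda>j s. a j * (jump_weight m s * of_real (r j powi - s)))"
    have aJ: "J j s = c j s - c (j - 1) s" if "j \<in> {1..n}" "s \<in> exponents m" for j s
      by (simp only: J_def a[OF that])
    \<comment> \<open>For -m and 2 - m the jumps are summed from the left, where \<open>c 0\<close>
      vanishes; for m and m + 2 from the right, where \<open>c n\<close> vanishes.\<close>
    have "c i s = (if s \<in> {- m, 2 - m} then \<Sum>j = 1..i. J j s else - (\<Sum>j\<in>{i<..n}. J j s))"
      if s: "s \<in> exponents m" for s
    proof -
      have "(\<Sum>j = 1..i. J j s) = (\<Sum>j = Suc 0..i. c j s - c (j - 1) s)"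
        using i s by (intro sum.cong) (auto simp: aJ)
      also have "\<dots> = c i s - c 0 s"
        by (rule sum_telescope''[where f = "\<lambda>j. c j s"]) simp
      finally have 1: "(\<Sum>j = 1..i. J j s) = c i s - c 0 s" .
      have "(\<Sum>j\<in>{i<..n}. J j s) = (\<Sum>j = Suc i..n. c j s - c (j - 1) s)"
        using i s by (intro sum.cong) (auto simp: aJ)
      also have "\<dots> = c n s - c i s"
        using i by (intro sum_telescope''[where f = "\<lambda>j. c j s"]) simp
      finally show ?thesis
        using 1 s c0 cn by (auto simp: exponents_def)
    qed
    then have "powsum 0 (exponents m) (c i) t = powsum 0 (exponents m)
        (\<lambda>s. if s \<in> {- m, 2 - m} then \<Sum>j = 1..i. J j s else - (\<Sum>j\<in>{i<..n}. J j s)) t"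
      unfolding powsum_0 by (intro sum.cong) simp_all
    also have "\<dots> = (\<Sum>j = 1..n. a j * complex_of_real (phi k (t / r j)))"
      unfolding J_def m_def
      by (rule sum_phi_eq_powsum [symmetric]) (use m \<open>t > 0\<close> i pos l u in \<open>auto simp: m_def\<close>)
    finally show ?thesis using \<sigma> by simp
  qed
  show ?thesis
  proof (rule ex_ex1I)
    show "\<exists>a. a \<in> {1..n} \<rightarrow>\<^sub>E (UNIV :: complex set) \<and>
           (\<forall>t\<ge>0. \<sigma> t = (\<Sum>j = 1..n. a j * complex_of_real (phi k (t / r j))))"
      using rep by (intro exI[of _ "restrict a {1..n}"]) simp
  next
    fix x y :: "nat \<Rightarrow> complex"
    assume x: "x \<in> {1..n} \<rightarrow>\<^sub>E UNIV \<and>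
           (\<forall>t\<ge>0. \<sigma> t = (\<Sum>j = 1..n. x j * complex_of_real (phi k (t / r j))))"
      and y: "y \<in> {1..n} \<rightarrow>\<^sub>E UNIV \<and>
           (\<forall>t\<ge>0. \<sigma> t = (\<Sum>j = 1..n. y j * complex_of_real (phi k (t / r j))))"
    \<comment> \<open>By linearity, the difference of two representations represents 0.\<close>
    have "(\<Sum>j = 1..n. (x j - y j) * complex_of_real (phi k (t / r j))) = 0" if "t > 0" for t
      using x y that by (simp add: left_diff_distrib sum_subtractf)
    then have "x i - y i = 0" if "i \<in> {1..n}" for i
      using sum_phi_eq_0_imp[OF assms(1,3,4), where d = "\<lambda>j. x j - y j"] that by blast
    then show "x = y"
      using x y by (intro PiE_ext[of x "{1..n}" "\<lambda>_. UNIV" y]) auto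
  qed
qed

end
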